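(* Let $n \geq 1$, let $S$ be a semifield and let $T\colon M_n(S) \to M_n(S)$ be a bijective linear map. Then the following are equivalent: (i) $T$ preserves $\mathcal{H}$; (ii) $T$ preserves $\leq_{\mathcal{H}}$; (iii) there exist $P, Q \in GL_n(S)$ such that either $T(A) = PAQ$ for all $A \in M_n(S)$ or $T(A) = PA^TQ$ for all $A \in M_n(S)$.
   Context: A semifield is a set $S$ with two associative commutative binary operations $+$ and $\times$ such that $\times$ distributes over $+$, there is an element $0$ which is an identity for $+$ and a zero element for $\times$, and $S \setminus \{0\}$ is a group under $\times$ with identity denoted $1$ (so every field is a semifield; additive inverses need not exist). $M_n(S)$ is the set of $n \times n$ matrices over $S$, viewed both as an $S$-module (entrywise addition and scaling) and as a monoid under matrix multiplication; $GL_n(S)$ is the group of multiplicatively invertible elements of $M_n(S)$; $A^T$ is the transpose of $A$. A map $T$ on $M_n(S)$ is linear if $T(A+B)=T(A)+T(B)$ and $T(sA)=sT(A)$ for all $A,B \in M_n(S)$, $s \in S$. Green's relations on $M_n(S)$: $A \leq_{\mathcal{L}} B$ if $A = XB$ for some $X \in M_n(S)$; $A \leq_{\mathcal{R}} B$ if $A = BX$ for some $X \in M_n(S)$; $A \leq_{\mathcal{H}} B$ if $A \leq_{\mathcal{L}} B$ and $A \leq_{\mathcal{R}} B$; $A\,\mathcal{H}\,B$ if $A \leq_{\mathcal{H}} B$ and $B \leq_{\mathcal{H}} A$. A map $T$ preserves a binary relation $\equiv$ on $M_n(S)$ if $A \equiv B$ implies $T(A) \equiv T(B)$ for all $A,B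 \in M_n(S)$. *)

theory Defs
  imports "HOL-Analysis.Analysis"
begin

(* comm_semiring_1 provides everything except inverses, including that 0 is absorbing
   and that 0 and 1 are distinct; closure of the nonzero elements under multiplication
   follows from the existence of inverses. *)
class semifield = comm_semiring_1 +
  assumes ex_mult_inverse: "a \<noteq> 0 \<Longrightarrow> \<exists>b. a * b = 1"

subclass (in field) semifield
proof
  fix a :: 'a
  assume "a \<noteq> 0"
  then have "a * inverse a = 1" by simp
  then show "\<exists>b. a * b = 1" by blast
qed

definition mat_scale :: "'a::times \<Rightarrow> 'a ^ 'n ^ 'm \<Rightarrow> 'a ^ 'n ^ 'm" where
  "mat_scale s A = (\<chi> i j. s * A $ i $ j)"

(* Linearity over a semiring; the library's linear and module_hom need scalars
   from a (commutative) ring. *)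
definition mat_linear :: "('a::semifield ^ 'n ^ 'n \<Rightarrow> 'a ^ 'n ^ 'n) \<Rightarrow> bool" where
  "mat_linear T \<longleftrightarrow>
     (\<forall>A B. T (A + B) = T A + T B) \<and> (\<forall>s A. T (mat_scale s A) = mat_scale s (T A))"

definition green_le_L :: "'a::semifield ^ 'n ^ 'n \<Rightarrow> 'a ^ 'n ^ 'n \<Rightarrow> bool" where
  "green_le_L A B \<longleftrightarrow> (\<exists>X. A = X ** B)"

definition green_le_R :: "'a::semifield ^ 'n ^ 'n \<Rightarrow> 'a ^ 'n ^ 'n \<Rightarrow> bool" where
  "green_le_R A B \<longleftrightarrow> (\<exists>X. A = B ** X)"

definition green_le_H :: "'a::semifield ^ 'n ^ 'n \<Rightarrow> 'a ^ 'n ^ 'n \<Rightarrow> bool" where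
  "green_le_H A B \<longleftrightarrow> green_le_L A B \<and> green_le_R A B"

definition green_H :: "'a::semifield ^ 'n ^ 'n \<Rightarrow> 'a ^ 'n ^ 'n \<Rightarrow> bool" where
  "green_H A B \<longleftrightarrow> green_le_H A B \<and> green_le_H B A"

definition preserves :: "('b \<Rightarrow> 'b) \<Rightarrow> ('b \<Rightarrow> 'b \<Rightarrow> bool) \<Rightarrow> bool" where
  "preserves T R \<longleftrightarrow> (\<forall>A B. R A B \<longrightarrow> R (T A) (T B))"

end

theory Submission
  imports Defs
begin

text \<open>
  The hard implication is that a linear bijection \<open>T\<close> preserving \<open>\<H>\<close> has the stated form. A matrix of
  rank one (an outer product) is \<open>\<H>\<close>-related only to scalar multiples of itself, so \<open>T\<close> cannot send to
  rank one any matrix having an \<open>\<H>\<close>-related matrix that is not a scalar multiple of it. A matrix that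
  is, up to invertible factors, \<open>E\<^bsub>pq\<^esub> + E\<^bsub>p'q'\<^esub> + N\<close> with \<open>N\<close> vanishing on the lines involved has such a
  partner, obtained by swapping rows \<open>p\<close> and \<open>p'\<close>.

  If \<open>- 1\<close> exists, then elimination brings every matrix of rank greater than one to this form, so \<open>inv T\<close>
  preserves rank one. Otherwise no sum of nonzero elements vanishes, and \<open>inv T\<close> sends matrix units to
  multiples of matrix units. In both cases \<open>inv T\<close> maps each matrix unit to an outer product
  \<open>x\<^bsub>ij\<^esub> y\<^bsub>ij\<^esub>\<^sup>T\<close>, and two units in a common line have parallel left or parallel right factors. A
  combinatorial argument on the grid shows that, after transposing if necessary,
  \<open>inv T E\<^bsub>ij\<^esub> = c\<^bsub>ij\<^esub> x\<^bsub>i\<^esub> y\<^bsub>j\<^esub>\<^sup>T\<close>. It remains to see that \<open>c\<close> has rank one; this follows by applying \<open>T\<close> to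
  two \<open>\<H>\<close>-related \<open>2 \<times> 2\<close> blocks, one of which is sent to the all-ones block.
\<close>

section \<open>Arithmetic in semifields\<close>

text \<open>The value at \<open>0\<close> is unspecified.\<close>
definition sinv :: "'a::semifield \<Rightarrow> 'a" where
  "sinv a = (SOME b. a * b = 1)"

lemma mult_sinv: "a * sinv a = 1" if "a \<noteq> 0" for a :: "'a::semifield"
  unfolding sinv_def using ex_mult_inverse[OF that] by (rule someI_ex)

lemma sinv_mult: "sinv a * a = 1" if "a \<noteq> 0" for a :: "'a::semifield"
  using mult_sinv[OF that] by (simp add: mult.commute)

lemma sinv_nonzero: "sinv a \<noteq> 0" if "a \<noteq> 0" for a :: "'a::semifield"
  using mult_sinv[OF that] by auto

lemma mult_sinv_cancel:
  fixes a b :: "'a::semifield"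
  assumes "a \<noteq> 0"
  shows "a * (sinv a * b) = b" "sinv a * (a * b) = b" "b * a * sinv a = b" "b * sinv a * a = b"
  using mult_sinv[OF assms] sinv_mult[OF assms] by (simp_all flip: mult.assoc) (simp_all add: mult.assoc)

lemma semifield_mult_eq_0: "a * b = 0 \<longleftrightarrow> a = 0 \<or> b = 0" for a b :: "'a::semifield"
  by (metis mult_sinv_cancel(2) mult_zero_left mult_zero_right)

lemma semifield_mult_left_cancel: "a * b = a * c \<longleftrightarrow> b = c" if "a \<noteq> 0" for a b c :: "'a::semifield"
  by (metis mult_sinv_cancel(2) that)

text \<open>The scalar \<open>m\<close> plays the role of -1, so \<open>m * a\<close> is an additive
  inverse of \<open>a\<close>. These rules stand in for subtraction.\<close>

lemma semifield_neg_cancel: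
  fixes m :: "'a::semifield"
  assumes "1 + m = 0"
  shows "a + m * a = 0" "m * a + a = 0" "a + (b + m * a) = b" "a + (m * a + b) = b"
proof -
  show 1: "a + m * a = 0" for a
    using assms by (metis distrib_right mult_1 mult_zero_left)
  then show "m * a + a = 0" by (simp add: add.commute)
  show "a + (b + m * a) = b" using 1 by (metis add.left_commute add_0_right)
  show "a + (m * a + b) = b" using 1 by (metis add.assoc add_0_left)
qed

text \<open>If \<open>a\<close> were nonzero, dividing by it would make \<open>sinv a * b\<close> an
  additive inverse of \<open>1\<close>.\<close>

lemma semifield_add_eq_0:
  fixes a b :: "'a::semifield"
  assumes "\<nexists>m::'a. 1 + m = 0" and "a + b = 0"
  shows "a = 0"
proof (rule ccontr)
  assume "a \<noteq> 0"
  then have "1 + sinv a * b = sinv a * (a + b)"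
    by (simp add: distrib_left sinv_mult)
  with assms show False by auto
qed

lemma semifield_sum_eq_0:
  fixes f :: "'b \<Rightarrow> 'a::semifield"
  assumes "\<nexists>m::'a. 1 + m = 0" and "finite S" and "sum f S = 0" and "x \<in> S"
  shows "f x = 0"
  using assms semifield_add_eq_0[OF assms(1)] by (metis sum.remove)

section \<open>Outer products and matrix units\<close>

definition outer :: "'a::semifield ^ 'm \<Rightarrow> 'a ^ 'n \<Rightarrow> 'a ^ 'n ^ 'm" where
  "outer x y = (\<chi> i j. x $ i * y $ j)"

definition rank_one :: "'a::semifield ^ 'n ^ 'm \<Rightarrow> bool" where
  "rank_one A \<longleftrightarrow> (\<exists>x y. x \<noteq> 0 \<and> y \<noteq> 0 \<and> A = outer x y)"

definition unit_mat :: "'m \<Rightarrow> 'n \<Rightarrow> 'a::semifield \<Rightarrow> 'a ^ 'n ^ 'm" where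
  "unit_mat i j c = (\<chi> a b. if a = i \<and> b = j then c else 0)"

text \<open>Requiring \<open>s\<close> to be nonzero makes this an equivalence relation on all
  vectors, zero included.\<close>

definition parallel :: "'a::semifield ^ 'n \<Rightarrow> 'a ^ 'n \<Rightarrow> bool" where
  "parallel x y \<longleftrightarrow> (\<exists>s. s \<noteq> 0 \<and> x = s *s y)"

lemma parallel_refl: "parallel x x"
  unfolding parallel_def by (intro exI[of _ 1]) simp

lemma parallel_sym: "parallel y x" if "parallel x y"
proof -
  from that obtain s where s: "s \<noteq> 0" "x = s *s y" by (auto simp: parallel_def)
  then have "y = sinv s *s x" by (simp add: vec_eq_iff mult_sinv_cancel)
  then show ?thesis using s sinv_nonzero by (auto simp: parallel_def)
qed

lemma parallel_trans: "parallel x z" if "parallel x y" "parallel y z"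
proof -
  from that obtain s t where "s \<noteq> 0" "x = s *s y" "t \<noteq> 0" "y = t *s z"
    by (auto simp: parallel_def)
  then show ?thesis
    by (auto simp: parallel_def semifield_mult_eq_0 vec_eq_iff mult.assoc intro!: exI[of _ "s * t"])
qed

lemma nonzero_component: "x \<noteq> 0 \<Longrightarrow> \<exists>i. x $ i \<noteq> 0" for x :: "'a::zero ^ 'n"
  by (auto simp: vec_eq_iff)

text \<open>Both \<open>a\<close> and \<open>b\<close> must be nonzero, so \<open>y\<close> is
  \<open>a * sinv b\<close> times \<open>z\<close>. The common factor \<open>D\<close> allows
  Cramer's rule to be used without dividing by the determinant.\<close>

lemma parallelI_multiples:
  fixes v y z :: "'a::semifield ^ 'n"
  assumes "y \<noteq> 0" "z \<noteq> 0" "D \<noteq> 0" "D *s y = a *s v" "D *s z = b *s v"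
  shows "parallel y z"
proof -
  have D0: "D *s x \<noteq> 0" if "x \<noteq> 0" for x :: "'a ^ 'n"
    using that \<open>D \<noteq> 0\<close> by (auto simp: vec_eq_iff semifield_mult_eq_0)
  have a: "a \<noteq> 0" using D0[OF assms(1)] assms(4) by auto
  have b: "b \<noteq> 0" using D0[OF assms(2)] assms(5) by auto
  have "y $ i = a * sinv b * z $ i" for i
  proof -
    have "D * y $ i = a * v $ i" and "D * z $ i = b * v $ i"
      using assms(4,5) by (auto simp: vec_eq_iff)
    then have "D * (a * sinv b * z $ i) = a * sinv b * (b * v $ i)"
      by (metis mult.left_commute)
    also have "\<dots> = D * y $ i"
      using \<open>D * y $ i = a * v $ i\<close> by (simp add: mult.assoc mult_sinv_cancel b)
    finally show ?thesis using assms(3) by (simp add: semifield_mult_left_cancel)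
  qed
  then show ?thesis unfolding parallel_def
    by (intro exI[of _ "a * sinv b"]) (simp add: vec_eq_iff semifield_mult_eq_0 a b sinv_nonzero)
qed

lemma parallel_if_minors_0:
  fixes x x' :: "'a::semifield ^ 'n"
  assumes "x \<noteq> 0" "x' \<noteq> 0" "\<And>i k. x $ i * x' $ k = x $ k * x' $ i"
  shows "parallel x x'"
proof -
  obtain k where k: "x' $ k \<noteq> 0" using nonzero_component[OF assms(2)] by blast
  show ?thesis
    by (rule parallelI_multiples[of _ _ "x' $ k" "x $ k" x' "x' $ k"])
       (use assms k in \<open>auto simp: vec_eq_iff mult.commute\<close>)
qed

text \<open>Cramer's rule: if some 2 by 2 minor of \<open>x\<close> and \<open>x'\<close> is
  nonzero, rows \<open>i\<close> and \<open>k\<close> of the equation can be solved for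
  \<open>y\<close> and \<open>y'\<close>, and both come out as multiples of
  \<open>v\<close>.\<close>

lemma outer_add_rank_le_one:
  fixes x x' u :: "'a::semifield ^ 'm" and y y' v :: "'a ^ 'n"
  assumes m: "1 + m = (0::'a)"
    and nz: "x \<noteq> 0" "x' \<noteq> 0" "y \<noteq> 0" "y' \<noteq> 0"
    and eq: "outer x y + outer x' y' = outer u v"
  shows "parallel x x' \<or> parallel y y'"
proof (rule disjCI)
  assume "\<not> parallel y y'"
  have comp: "x $ i * y $ j + x' $ i * y' $ j = u $ i * v $ j" for i j
    using eq by (simp add: vec_eq_iff outer_def)
  note cancel = semifield_neg_cancel(1)[OF m]
  show "parallel x x'"
  proof (rule parallel_if_minors_0[OF nz(1,2)], rule ccontr)
    fix i k
    assume neq: "x $ i * x' $ k \<noteq> x $ k * x' $ i"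
    \<comment> \<open>This is the minor of \<open>x\<close> and \<open>x'\<close> on the components
      \<open>i\<close> and \<open>k\<close>, with \<open>m\<close> as -1.\<close>
    define D where "D = x $ i * x' $ k + m * (x $ k * x' $ i)"
    have "D \<noteq> 0"
    proof
      assume "D = 0"
      then have "x $ i * x' $ k + (x $ k * x' $ i + m * (x $ k * x' $ i)) = x $ k * x' $ i"
        unfolding D_def by (metis add.left_commute add_0_right)
      with neq show False by (simp add: cancel)
    qed
    have "D * y $ j = (x' $ k * u $ i + m * (x' $ i * u $ k)) * v $ j" for j
    proof -
      have "(x' $ k * u $ i + m * (x' $ i * u $ k)) * v $ j =
          x' $ k * (u $ i * v $ j) + m * (x' $ i * (u $ k * v $ j))"
        by (simp add: algebra_simps)
      also have "\<dots> = D * y $ j + (x' $ i * x' $ k * y' $ j + m * (x' $ i * x' $ k * y' $ j))"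
        unfolding comp[symmetric] D_def by (simp add: algebra_simps)
      finally show ?thesis by (simp add: cancel)
    qed
    moreover have "D * y' $ j = (x $ i * u $ k + m * (x $ k * u $ i)) * v $ j" for j
    proof -
      have "(x $ i * u $ k + m * (x $ k * u $ i)) * v $ j =
          x $ i * (u $ k * v $ j) + m * (x $ k * (u $ i * v $ j))"
        by (simp add: algebra_simps)
      also have "\<dots> = D * y' $ j + (x $ i * x $ k * y $ j + m * (x $ i * x $ k * y $ j))"
        unfolding comp[symmetric] D_def by (simp add: algebra_simps)
      finally show ?thesis by (simp add: cancel)
    qed
    ultimately have "parallel y y'"
      by (intro parallelI_multiples[OF nz(3,4) \<open>D \<noteq> 0\<close>,
            of "x' $ k * u $ i + m * (x' $ i * u $ k)" v "x $ i * u $ k + m * (x $ k * u $ i)"])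
        (simp_all add: vec_eq_iff distrib_right)
    with \<open>\<not> parallel y y'\<close> show False ..
  qed
qed

section \<open>Green's relations\<close>

lemma green_le_H_mult:
  assumes "invertible P" "invertible Q" "green_le_H A B"
  shows "green_le_H (P ** A ** Q) (P ** B ** Q)"
proof -
  obtain X Y where X: "A = X ** B" and Y: "A = B ** Y"
    using assms(3) unfolding green_le_H_def green_le_L_def green_le_R_def by blast
  obtain P' Q' where P': "P' ** P = mat 1" and Q': "Q ** Q' = mat 1"
    using assms(1,2) by (auto simp: invertible_def)
  have "P ** A ** Q = (P ** X ** P') ** (P ** B ** Q)"
    using P' unfolding X by (metis matrix_mul_assoc matrix_mul_rid)
  moreover have "P ** A ** Q = (P ** B ** Q) ** (Q' ** Y ** Q)"
    using Q' unfolding Y by (metis matrix_mul_assoc matrix_mul_rid)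
  ultimately show ?thesis
    unfolding green_le_H_def green_le_L_def green_le_R_def by blast
qed

lemma green_H_mult:
  assumes "invertible P" "invertible Q" "green_H A B"
  shows "green_H (P ** A ** Q) (P ** B ** Q)"
  using assms green_le_H_mult unfolding green_H_def by blast

lemma green_le_H_transpose:
  assumes "green_le_H A B"
  shows "green_le_H (transpose A) (transpose B)"
  using assms unfolding green_le_H_def green_le_L_def green_le_R_def
  by (metis matrix_transpose_mul)

lemma green_H_transpose: "green_H A B \<Longrightarrow> green_H (transpose A) (transpose B)"
  unfolding green_H_def by (blast intro: green_le_H_transpose)

text \<open>Every row of \<open>B = X ** A\<close> is a multiple of \<open>y\<close> and every
  column of \<open>B = A ** Y\<close> is a multiple of \<open>x\<close>. Comparing the two
  descriptions in a column where \<open>y\<close> is nonzero shows that the row coefficients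
  \<open>z\<close> are themselves a multiple of \<open>x\<close>.\<close>

lemma green_le_H_rank_one:
  assumes "rank_one A" "green_le_H B A"
  shows "\<exists>s. B = mat_scale s A"
proof -
  obtain x y where xy: "x \<noteq> 0" "y \<noteq> 0" "A = outer x y"
    using assms(1) by (auto simp: rank_one_def)
  obtain X Y where X: "B = X ** A" and Y: "B = A ** Y"
    using assms(2) unfolding green_le_H_def green_le_L_def green_le_R_def by blast
  define z where "z = (\<chi> i. \<Sum>k\<in>UNIV. X $ i $ k * x $ k)"
  define w where "w = (\<chi> j. \<Sum>k\<in>UNIV. y $ k * Y $ k $ j)"
  have z: "B $ i $ j = z $ i * y $ j" for i j
    unfolding X xy(3) z_def by (simp add: matrix_matrix_mult_def outer_def sum_distrib_right mult.assoc)
  have w: "B $ i $ j = x $ i * w $ j" for i j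
    unfolding Y xy(3) w_def by (simp add: matrix_matrix_mult_def outer_def sum_distrib_left mult.assoc)
  obtain q where q: "y $ q \<noteq> 0" using nonzero_component[OF xy(2)] by blast
  have "z $ i = x $ i * (w $ q * sinv (y $ q))" for i
    using z[of i q] w[of i q] mult_sinv_cancel(3)[OF q] by (metis mult.assoc)
  then have "B = mat_scale (w $ q * sinv (y $ q)) A"
    by (simp add: vec_eq_iff z mat_scale_def xy(3) outer_def ac_simps)
  then show ?thesis ..
qed

section \<open>Swaps of rows and columns\<close>

lemma sum_if_eq: "(\<Sum>k\<in>UNIV. (if k = i then c else 0) * f k) = c * f i"
  "(\<Sum>k\<in>UNIV. f k * (if k = i then c else 0)) = f i * c"
  "(\<Sum>k\<in>UNIV. (if i = k then c else 0) * f k) = c * f i"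
  "(\<Sum>k\<in>UNIV. f k * (if i = k then c else 0)) = f i * c"
  for f :: "'b::finite \<Rightarrow> 'a::semiring_1"
  by (simp_all add: if_distrib if_distribR cong: if_cong)

text \<open>Here \<open>Transposition.transpose p q\<close> is the permutation exchanging two
  indices, not the transpose of a matrix.\<close>

definition swap_mat :: "'n \<Rightarrow> 'n \<Rightarrow> 'a::semifield ^ 'n ^ 'n" where
  "swap_mat p q = (\<chi> i j. if Transposition.transpose p q i = j then 1 else 0)"

lemma swap_mat_mult: "(swap_mat p q ** M) $ i $ j = M $ Transposition.transpose p q i $ j"
  by (simp add: matrix_matrix_mult_def swap_mat_def sum_if_eq)

lemma mult_swap_mat: "(M ** swap_mat p q) $ i $ j = M $ i $ Transposition.transpose p q j"
proof -
  have "(Transposition.transpose p q k = j) = (k = Transposition.transpose p q j)" for k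
    by (metis transpose_involutory)
  then show ?thesis
    by (simp add: matrix_matrix_mult_def swap_mat_def sum_if_eq)
qed

text \<open>Swap matrices are involutions, so the row swap can be undone from the left. By the
  assumption it is also a column swap, which can be undone from the right.\<close>

lemma green_H_swap:
  assumes "swap_mat p p' ** N = N ** swap_mat q q'"
  shows "green_H (swap_mat p p' ** N) N"
proof -
  have "N = swap_mat p p' ** (swap_mat p p' ** N)" "N = (N ** swap_mat q q') ** swap_mat q q'"
    by (simp_all add: vec_eq_iff swap_mat_mult mult_swap_mat)
  then show ?thesis
    using assms unfolding green_H_def green_le_H_def green_le_L_def green_le_R_def by metis
qed

section \<open>Linear maps and matrix units\<close>

lemma mat_linear_unit_expansion:
  assumes "mat_linear U"
  shows "U Z $ a $ b = (\<Sum>i\<in>UNIV. \<Sum>j\<in>UNIV. Z $ i $ j * U (unit_mat i j 1) $ a $ b)"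
proof -
  have add: "U (A + B) = U A + U B" and scale: "U (mat_scale s A) = mat_scale s (U A)" for A B s
    using assms by (auto simp: mat_linear_def)
  have zero: "U 0 = 0"
    using scale[of 0 0] by (simp add: mat_scale_def zero_vec_def)
  have sum: "U (sum F S) = (\<Sum>s\<in>S. U (F s))" if "finite S" for F and S :: "'c set"
    using that by (induction S) (simp_all add: zero add)
  have "Z = (\<Sum>i\<in>UNIV. \<Sum>j\<in>UNIV. mat_scale (Z $ i $ j) (unit_mat i j 1))"
  proof (simp add: vec_eq_iff mat_scale_def unit_mat_def, intro allI)
    fix a b
    have "(\<Sum>i\<in>UNIV. \<Sum>j\<in>UNIV. Z $ i $ j * (if a = i \<and> b = j then 1 else 0)) =
        (\<Sum>i\<in>UNIV. if a = i then Z $ i $ b else 0)"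
      by (intro sum.cong refl) (simp add: sum_if_eq)
    then show "Z $ a $ b = (\<Sum>i\<in>UNIV. \<Sum>j\<in>UNIV. Z $ i $ j * (if a = i \<and> b = j then 1 else 0))"
      by simp
  qed
  then have "U Z = (\<Sum>i\<in>UNIV. \<Sum>j\<in>UNIV. mat_scale (Z $ i $ j) (U (unit_mat i j 1)))"
    by (metis (no_types, lifting) sum[OF finite_class.finite_UNIV] scale sum.cong)
  then show ?thesis by (simp add: mat_scale_def)
qed

lemma mat_scale_mult:
  "mat_scale s A ** B = mat_scale s (A ** B)" "A ** mat_scale s B = mat_scale s (A ** B)"
  for A B :: "'a::semifield ^ 'n ^ 'n"
  by (simp_all add: mat_scale_def matrix_matrix_mult_def vec_eq_iff sum_distrib_left ac_simps)

lemma mat_linear_inv: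
  assumes "bij T" "mat_linear T"
  shows "mat_linear (inv T)"
proof -
  have T: "T (inv T A) = A" "inv T (T A) = A" for A
    using assms(1) by (simp_all add: bij_is_surj surj_f_inv_f bij_is_inj)
  have "T (inv T A + inv T B) = A + B" "T (mat_scale s (inv T A)) = mat_scale s A" for A B s
    using assms(2) by (simp_all add: mat_linear_def T)
  then have "inv T (A + B) = inv T A + inv T B" "inv T (mat_scale s A) = mat_scale s (inv T A)" for A B s
    by (metis T(2))+
  then show ?thesis by (simp add: mat_linear_def)
qed

lemma mat_linear_0: "mat_linear T \<Longrightarrow> T 0 = 0"
proof -
  assume "mat_linear T"
  then have "T (mat_scale 0 0) = mat_scale 0 (T 0)" by (simp add: mat_linear_def)
  then show ?thesis by (simp add: mat_scale_def zero_vec_def)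
qed

lemma rank_one_nonzero: "rank_one A \<Longrightarrow> A \<noteq> 0"
  by (auto simp: rank_one_def outer_def vec_eq_iff semifield_mult_eq_0)

lemma rank_one_units_collinear:
  fixes a b :: "'a::semifield"
  assumes "i = k \<or> j = l" "(i, j) \<noteq> (k, l)" "a \<noteq> 0"  "b \<noteq> 0"
  shows "rank_one (unit_mat i j a + unit_mat k l b :: 'a ^ 'n ^ 'm)"
proof -
  have axis: "axis p c + axis q d \<noteq> 0" if "p \<noteq> q" "c \<noteq> (0::'a)" for p q :: "'c::finite" and c d
    using that by (auto simp: axis_def vec_eq_iff intro!: exI[of _ p])
  have ax: "axis p (1::'a) \<noteq> 0" for p :: "'c::finite"
    by (auto simp: axis_def vec_eq_iff intro!: exI[of _ p])
  show ?thesis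
  proof (cases "i = k")
    case True
    then have "unit_mat i j a + unit_mat k l b = outer (axis i 1) (axis j a + axis l b)"
      by (simp add: unit_mat_def outer_def axis_def vec_eq_iff)
    with True show ?thesis using assms axis[of j l a b] ax unfolding rank_one_def by blast
  next
    case False
    then have "unit_mat i j a + unit_mat k l b = outer (axis i a + axis k b) (axis j 1)"
      using assms by (simp add: unit_mat_def outer_def axis_def vec_eq_iff)
    with False show ?thesis using assms axis[of i k a b] ax unfolding rank_one_def by blast
  qed
qed

section \<open>Pivot matrices for Gaussian elimination\<close>

definition replace_col :: "'n \<Rightarrow> 'a::semifield ^ 'n \<Rightarrow> 'a ^ 'n ^ 'n" where
  "replace_col p x = (\<chi> i j. if j = p then x $ i else if i = j then 1 else 0)"

lemma replace_col_mult:
  "(replace_col p x ** M) $ i $ j = x $ i * M $ p $ j + (if i = p then 0 else M $ i $ j)"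
proof -
  have "(replace_col p x ** M) $ i $ j =
      (\<Sum>k\<in>UNIV. (if k = p then x $ i else 0) * M $ k $ j +
        (if k = i then if i = p then 0 else 1 else 0) * M $ k $ j)"
    unfolding matrix_matrix_mult_def replace_col_def by (auto intro!: sum.cong)
  then show ?thesis by (simp add: sum.distrib sum_if_eq)
qed

lemma mult_transpose_replace_col:
  "(M ** transpose (replace_col q y)) $ i $ j = M $ i $ q * y $ j + (if j = q then 0 else M $ i $ j)"
proof -
  have "M ** transpose (replace_col q y) = transpose (replace_col q y ** transpose M)"
    by (simp add: matrix_transpose_mul)
  then have "(M ** transpose (replace_col q y)) $ i $ j = (replace_col q y ** transpose M) $ j $ i"
    by (simp add: transpose_def)
  then show ?thesis by (simp add: replace_col_mult transpose_def mult.commute)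
qed

text \<open>The inverse has the same shape, with the pivot inverted and the other entries of the
  column negated and divided by the pivot.\<close>

lemma invertible_replace_col:
  fixes x :: "'a::semifield ^ 'n"
  assumes m: "1 + m = (0::'a)" and x: "x $ p \<noteq> 0"
  shows "invertible (replace_col p x)"
proof -
  define z where "z = (\<chi> i. if i = p then sinv (x $ p) else m * (x $ i * sinv (x $ p)))"
  have "replace_col p x ** replace_col p z = mat 1"
    unfolding vec_eq_iff replace_col_mult
    by (auto simp: replace_col_def mat_def z_def mult_sinv x semifield_neg_cancel[OF m])
  moreover have "replace_col p z ** replace_col p x = mat 1"
    unfolding vec_eq_iff replace_col_mult
    by (auto simp: replace_col_def mat_def z_def sinv_mult x semifield_neg_cancel[OF m] mult.assoc)
  ultimately show ?thesis unfolding invertible_def by blast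
qed

lemma invertible_transpose': "invertible P \<Longrightarrow> invertible (transpose P)"
  for P :: "'a::semifield ^ 'n ^ 'n"
  unfolding invertible_def by (metis matrix_transpose_mul transpose_mat)

section \<open>Preimages of matrix units\<close>

locale H_preserver =
  fixes T :: "'a::semifield ^ 'n ^ 'n \<Rightarrow> 'a ^ 'n ^ 'n"
  assumes bij: "bij T" and linear: "mat_linear T" and preserves: "preserves T green_H"
begin

lemma T_inv: "T (inv T A) = A" and inv_T: "inv T (T A) = A"
  using bij by (simp_all add: bij_is_surj surj_f_inv_f bij_is_inj)

lemma T_eq_iff: "T A = T B \<longleftrightarrow> A = B"
  using bij by (metis inv_T)

lemma T_add: "T (A + B) = T A + T B" and T_scale: "T (mat_scale s A) = mat_scale s (T A)"
  using linear by (auto simp: mat_linear_def)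

lemma linear_inv: "mat_linear (inv T)"
  using bij linear by (rule mat_linear_inv)

lemma inv_add: "inv T (A + B) = inv T A + inv T B"
  and inv_scale: "inv T (mat_scale s A) = mat_scale s (inv T A)"
  using linear_inv by (auto simp: mat_linear_def)

lemma T_0: "T 0 = 0"
  using linear by (rule mat_linear_0)

text \<open>Proportionality holds between the images because one of them has rank one. Linearity and
  injectivity of \<open>T\<close> carry it back.\<close>

lemma scalar_if_green_H:
  assumes "rank_one (T A)" "green_H B A"
  shows "\<exists>s. B = mat_scale s A"
proof -
  have "green_H (T B) (T A)"
    using assms(2) preserves unfolding preserves_def by blast
  then obtain s where "T B = mat_scale s (T A)"
    using green_le_H_rank_one[OF assms(1)] unfolding green_H_def by blast
  then show ?thesis by (metis T_scale T_eq_iff)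
qed

text \<open>The swapped matrix vanishes at \<open>(p, q)\<close>, so it is not a scalar multiple of \<open>N\<close>.\<close>
lemma not_rank_one_swap:
  fixes P Q N :: "'a ^ 'n ^ 'n"
  assumes "invertible P" "invertible Q"
    and "swap_mat p p' ** N = N ** swap_mat q q'"
    and "N $ p $ q \<noteq> 0" "N $ p' $ q = 0"
  shows "\<not> rank_one (T (P ** N ** Q))"
proof
  let ?S = "swap_mat p p' :: 'a ^ 'n ^ 'n"
  assume "rank_one (T (P ** N ** Q))"
  then obtain s where s: "P ** (?S ** N) ** Q = mat_scale s (P ** N ** Q)"
    using scalar_if_green_H green_H_mult[OF assms(1,2) green_H_swap[OF assms(3)]] by blast
  obtain P' Q' where P': "P' ** P = mat 1" and Q': "Q ** Q' = mat 1"
    using assms(1,2) by (auto simp: invertible_def)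
  have cancel: "P' ** (P ** M ** Q) ** Q' = M" for M
    using P' Q' by (metis matrix_mul_assoc matrix_mul_lid matrix_mul_rid)
  have eq: "?S ** N = mat_scale s N"
    using arg_cong[OF s, of "\<lambda>M. P' ** M ** Q'"] by (simp add: mat_scale_mult cancel)
  have "(?S ** N) $ p $ q = 0"
    using assms(5) by (simp add: swap_mat_mult)
  then have "s = 0"
    using assms(4) by (simp add: eq mat_scale_def semifield_mult_eq_0)
  then have "(?S ** N) $ p' $ q = 0"
    by (simp add: eq mat_scale_def)
  then show False using assms(4) by (simp add: swap_mat_mult)
qed

text \<open>Either swap turns the two units into those at \<open>(p', q)\<close> and
  \<open>(p, q')\<close>, and it leaves \<open>N\<close> fixed because \<open>N\<close> vanishes on
  the lines that move.\<close>

lemma swap_commute_block: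
  assumes "p \<noteq> p'" "q \<noteq> q'"
    and "\<And>j. N $ p $ j = 0" "\<And>j. N $ p' $ j = 0" "\<And>i. N $ i $ q = 0" "\<And>i. N $ i $ q' = 0"
  shows "swap_mat p p' ** (unit_mat p q 1 + unit_mat p' q' 1 + N) =
    (unit_mat p q 1 + unit_mat p' q' 1 + N) ** swap_mat q q'"
  unfolding vec_eq_iff swap_mat_mult mult_swap_mat
  using assms by (auto simp: unit_mat_def Transposition.transpose_def)

text \<open>Two elimination steps, with pivots \<open>(p, q)\<close> and \<open>(p', q')\<close>; a nonzero second pivot would
  contradict \<open>not_rank_one_swap\<close>.\<close>
lemma rank_one_if_image_rank_one:
  assumes m: "1 + m = (0::'a)" and T: "rank_one (T A)"
  shows "rank_one A"
proof -
  note neg = semifield_neg_cancel[OF m]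
  have "A \<noteq> 0" using rank_one_nonzero[OF T] T_0 by auto
  then obtain p q where pq: "A $ p $ q \<noteq> 0" by (auto simp: vec_eq_iff)
  define x where "x = (\<chi> i. A $ i $ q * sinv (A $ p $ q))"
  define y where "y = A $ p"
  \<comment> \<open>With \<open>m\<close> as -1, this subtracts the outer product of the pivot
    column, scaled to have entry 1 at \<open>p\<close>, with the pivot row. Row \<open>p\<close> and
    column \<open>q\<close> become zero.\<close>
  define A1 where "A1 = (\<chi> i j. A $ i $ j + m * (x $ i * y $ j))"
  have A: "A = outer x y + A1"
    by (simp add: vec_eq_iff outer_def A1_def neg)
  have x: "x $ p = 1" and y: "y $ q \<noteq> 0"
    using pq by (simp_all add: x_def y_def mult_sinv)
  have A1p: "A1 $ p $ j = 0" for j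
    by (simp add: A1_def x neg) (simp add: y_def neg)
  have A1q: "A1 $ i $ q = 0" for i
    by (simp add: A1_def x_def y_def mult_sinv_cancel pq neg)
  show ?thesis
  proof (cases "A1 = 0")
    case True
    have "x \<noteq> 0" "y \<noteq> 0" using x y by auto
    with True A show ?thesis unfolding rank_one_def by auto
  next
    case False
    then obtain p' q' where pq': "A1 $ p' $ q' \<noteq> 0" by (auto simp: vec_eq_iff)
    have ne: "p' \<noteq> p" "q' \<noteq> q" using pq' A1p A1q by auto
    define x' where "x' = (\<chi> i. A1 $ i $ q' * sinv (A1 $ p' $ q'))"
    define y' where "y' = A1 $ p'"
    define A2 where "A2 = (\<chi> i j. A1 $ i $ j + m * (x' $ i * y' $ j))"
    have A1: "A1 = outer x' y' + A2"
      by (simp add: vec_eq_iff outer_def A2_def neg)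
    have x': "x' $ p' = 1" "x' $ p = 0" and y': "y' $ q' \<noteq> 0" "y' $ q = 0"
      using pq' by (simp_all add: x'_def y'_def mult_sinv A1p A1q)
    have A2: "A2 $ p $ j = 0" "A2 $ p' $ j = 0" "A2 $ i $ q = 0" "A2 $ i $ q' = 0" for i j
      by (simp_all add: A2_def A1p A1q x' y' neg)
        (simp_all add: x'_def y'_def mult_sinv_cancel pq' neg)
    define N where "N = unit_mat p q 1 + unit_mat p' q' 1 + A2"
    \<comment> \<open>The matrix \<open>A\<close> is rebuilt from \<open>N\<close> by undoing the
      elimination: the left factors turn the columns of the two units into \<open>x'\<close> and
      \<open>x\<close>, the right factors turn their rows into \<open>y'\<close> and
      \<open>y\<close>. The later factors do not disturb the earlier results because
      \<open>x' $ p = 0\<close> and \<open>y' $ q = 0\<close>.\<close>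
    have "(replace_col p' x' ** N) $ i $ j =
        (if j = q' then x' $ i else 0) + unit_mat p q 1 $ i $ j + A2 $ i $ j" for i j
      unfolding replace_col_mult N_def using ne by (auto simp: unit_mat_def A2 x')
    then have "(replace_col p x ** (replace_col p' x' ** N)) $ i $ j =
        (if j = q' then x' $ i else 0) + (if j = q then x $ i else 0) + A2 $ i $ j" for i j
      unfolding replace_col_mult[of p] using ne by (auto simp: unit_mat_def A2 x' x)
    then have "(replace_col p x ** (replace_col p' x' ** N) ** transpose (replace_col q' y')) $ i $ j =
        x' $ i * y' $ j + (if j = q then x $ i else 0) + A2 $ i $ j" for i j
      unfolding mult_transpose_replace_col using ne by (auto simp: A2)
    then have "(replace_col p x ** (replace_col p' x' ** N) ** transpose (replace_col q' y')
        ** transpose (replace_col q y)) $ i $ j = x $ i * y $ j + (x' $ i * y' $ j + A2 $ i $ j)" for i j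
      unfolding mult_transpose_replace_col[of _ q y] using ne by (auto simp: A2 y' ac_simps)
    then have "A = (replace_col p x ** replace_col p' x') ** N **
        (transpose (replace_col q' y') ** transpose (replace_col q y))"
      by (simp add: A A1 vec_eq_iff outer_def matrix_mul_assoc)
    moreover have "invertible (replace_col p x ** replace_col p' x')"
      "invertible (transpose (replace_col q' y') ** transpose (replace_col q y))"
      by (intro invertible_mult invertible_transpose' invertible_replace_col[OF m]; simp add: x x' y y')+
    moreover have "swap_mat p p' ** N = N ** swap_mat q q'"
      unfolding N_def using ne A2 by (intro swap_commute_block) auto
    moreover have "N $ p $ q \<noteq> 0" "N $ p' $ q = 0"
      using ne by (auto simp: N_def unit_mat_def A2)
    ultimately show ?thesis
      using not_rank_one_swap T by metis
  qed
qed

text \<open>Nothing cancels in \<open>T M = E\<^bsub>ij\<^esub>\<close>, so every unit in the support of \<open>M\<close> is sent to a multiple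
  of \<open>E\<^bsub>ij\<^esub>\<close>, and injectivity leaves only one.\<close>
lemma inv_unit_mat_antinegative:
  assumes "\<nexists>m::'a. 1 + m = 0"
  shows "\<exists>p q c. c \<noteq> 0 \<and> inv T (unit_mat i j 1) = unit_mat p q c"
proof -
  define M where "M = inv T (unit_mat i j 1)"
  have TM: "T M = unit_mat i j 1" by (simp add: M_def T_inv)
  have "unit_mat i j (1::'a) \<noteq> 0" by (auto simp: unit_mat_def vec_eq_iff)
  then have "M \<noteq> 0" using TM T_0 by auto
  then obtain p q where pq: "M $ p $ q \<noteq> 0" by (auto simp: vec_eq_iff)
  define t where "t = T (unit_mat p q 1) $ i $ j"
  have zero: "T (unit_mat p q 1) $ a $ b = 0" if "(a, b) \<noteq> (i, j)" for a b
  proof -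
    have "(\<Sum>i\<in>UNIV. \<Sum>j\<in>UNIV. M $ i $ j * T (unit_mat i j 1) $ a $ b) = 0"
      unfolding mat_linear_unit_expansion[OF linear, symmetric] TM using that
      by (auto simp: unit_mat_def)
    then have "M $ p $ q * T (unit_mat p q 1) $ a $ b = 0"
      by (rule semifield_sum_eq_0[OF assms finite semifield_sum_eq_0[OF assms finite]]) auto
    with pq show ?thesis by (simp add: semifield_mult_eq_0)
  qed
  then have "T (unit_mat p q 1) = mat_scale t (T M)"
    unfolding TM by (auto simp: vec_eq_iff unit_mat_def[of i j] mat_scale_def t_def)
  then have eq: "unit_mat p q 1 = mat_scale t M"
    by (metis T_scale T_eq_iff)
  then have "unit_mat p q 1 $ p $ q = mat_scale t M $ p $ q" by simp
  then have t: "t \<noteq> 0" by (auto simp: unit_mat_def mat_scale_def)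
  have "M = mat_scale (sinv t) (mat_scale t M)"
    by (simp add: mat_scale_def vec_eq_iff mult_sinv_cancel t)
  also have "\<dots> = unit_mat p q (sinv t)"
    by (simp flip: eq) (simp add: unit_mat_def mat_scale_def vec_eq_iff)
  finally show ?thesis using sinv_nonzero[OF t] unfolding M_def by (intro exI conjI)
qed

text \<open>If -1 exists, the sum of two distinct collinear units has rank one, hence so has its
  preimage, and \<open>outer_add_rank_le_one\<close> applies. Otherwise the preimages are multiples
  of units; were these not collinear, their sum would have a swap partner although a suitably scaled
  version of the collinear pair, of rank one, is its image.\<close>

lemma inv_units_collinear:
  "\<exists>x y. (\<forall>i j. x i j \<noteq> 0 \<and> y i j \<noteq> 0 \<and> inv T (unit_mat i j 1) = outer (x i j) (y i j)) \<and>
     (\<forall>i j k l. i = k \<or> j = l \<longrightarrow> parallel (x i j) (x k l) \<or> parallel (y i j) (y k l))"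
proof (cases "\<exists>m::'a. 1 + m = 0")
  case True
  then obtain m :: 'a where m: "1 + m = 0" ..
  have "rank_one (unit_mat i j (1::'a))" for i :: 'n and j :: 'n
  proof -
    have "unit_mat i j (1::'a) = outer (axis i 1) (axis j 1)" "axis i (1::'a) \<noteq> 0" "axis j (1::'a) \<noteq> 0"
      by (auto simp: unit_mat_def outer_def axis_def vec_eq_iff)
    then show ?thesis unfolding rank_one_def by blast
  qed
  then have "rank_one (inv T (unit_mat i j 1))" for i j
    by (simp add: rank_one_if_image_rank_one[OF m] T_inv)
  then have "\<forall>i j. \<exists>x y. x \<noteq> 0 \<and> y \<noteq> 0 \<and> inv T (unit_mat i j 1) = outer x y"
    by (simp add: rank_one_def)
  then obtain x y where xy:
    "\<And>i j. x i j \<noteq> 0" "\<And>i j. y i j \<noteq> 0" "\<And>i j. inv T (unit_mat i j 1) = outer (x i j) (y i j)"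
    by metis
  have "parallel (x i j) (x k l) \<or> parallel (y i j) (y k l)" if "i = k \<or> j = l" for i j k l
  proof (cases "(i, j) = (k, l)")
    case True
    then show ?thesis by (simp add: parallel_refl)
  next
    case False
    have "rank_one (inv T (unit_mat i j 1 + unit_mat k l 1))"
      by (rule rank_one_if_image_rank_one[OF m])
        (simp add: T_inv rank_one_units_collinear[OF that False])
    then obtain u v where "outer (x i j) (y i j) + outer (x k l) (y k l) = outer u v"
      unfolding rank_one_def inv_add xy by blast
    from outer_add_rank_le_one[OF m _ _ _ _ this] show ?thesis using xy by blast
  qed
  with xy show ?thesis by blast
next
  case False
  have "\<forall>i j. \<exists>p q c. c \<noteq> 0 \<and> inv T (unit_mat i j 1) = unit_mat p q c"
    using inv_unit_mat_antinegative[OF False] by blast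
  then obtain p q c where pqc: "\<And>i j. c i j \<noteq> 0"
    "\<And>i j. inv T (unit_mat i j 1) = unit_mat (p i j) (q i j) (c i j)"
    by metis
  define x :: "'n \<Rightarrow> 'n \<Rightarrow> 'a ^ 'n" where "x i j = axis (p i j) (c i j)" for i j
  define y :: "'n \<Rightarrow> 'n \<Rightarrow> 'a ^ 'n" where "y i j = axis (q i j) 1" for i j
  have xy: "x i j \<noteq> 0" "y i j \<noteq> 0" "inv T (unit_mat i j 1) = outer (x i j) (y i j)" for i j
    using pqc by (auto simp: x_def y_def axis_def vec_eq_iff outer_def unit_mat_def)
  have T_unit: "T (unit_mat (p i j) (q i j) 1) = unit_mat i j (sinv (c i j))" for i j
  proof -
    have "unit_mat (p i j) (q i j) 1 = mat_scale (sinv (c i j)) (inv T (unit_mat i j 1))"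
      by (simp add: pqc) (simp add: unit_mat_def mat_scale_def vec_eq_iff sinv_mult pqc)
    then have "T (unit_mat (p i j) (q i j) 1) = mat_scale (sinv (c i j)) (unit_mat i j 1)"
      by (simp add: T_scale T_inv)
    then show ?thesis by (simp add: unit_mat_def mat_scale_def vec_eq_iff)
  qed
  have "p i j = p k l \<or> q i j = q k l" if "i = k \<or> j = l" for i j k l
  proof (rule ccontr)
    assume ne: "\<not> ?thesis"
    \<comment> \<open>The summand \<open>0\<close> and the factors \<open>mat 1\<close> below only
      bring the matrix into the shape expected by \<open>swap_commute_block\<close> and
      \<open>not_rank_one_swap\<close>.\<close>
    let ?N = "unit_mat (p i j) (q i j) 1 + unit_mat (p k l) (q k l) 1 + 0 :: 'a ^ 'n ^ 'n"
    have "rank_one (T (mat 1 ** ?N ** mat 1))"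
      unfolding matrix_mul_lid matrix_mul_rid T_add T_unit T_0 add_0_right
      by (rule rank_one_units_collinear[OF that]) (use ne pqc in \<open>auto simp: sinv_nonzero\<close>)
    moreover have "\<not> rank_one (T (mat 1 ** ?N ** mat 1))"
      by (rule not_rank_one_swap[OF _ _ swap_commute_block])
        (use ne in \<open>auto simp: unit_mat_def invertible_def\<close>)
    ultimately show False by blast
  qed
  then have line: "i = k \<or> j = l \<longrightarrow> p i j = p k l \<or> q i j = q k l" for i j k l by blast
  have axis: "parallel (axis a s) (axis a t)" if "s \<noteq> 0" "t \<noteq> 0" for a :: 'n and s t :: 'a
    unfolding parallel_def
    by (intro exI[of _ "s * sinv t"])
      (use that in \<open>simp add: axis_def vec_eq_iff semifield_mult_eq_0 sinv_nonzero mult_sinv_cancel\<close>)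
  have "parallel (x i j) (x k l) \<or> parallel (y i j) (y k l)" if "i = k \<or> j = l" for i j k l
    using line[of i k j l] that axis[OF pqc(1) pqc(1)] axis[OF one_neq_zero one_neq_zero]
    unfolding x_def y_def by (elim disjE) auto
  with xy show ?thesis by blast
qed

end

section \<open>Rank of the coefficient matrix\<close>

text \<open>A preimage \<open>Z\<close> of the identity yields a right inverse \<open>Z ** Q\<close>
  of \<open>P\<close> and a left inverse \<open>P ** Z\<close> of \<open>Q\<close>. Injectivity
  makes both two-sided.\<close>

lemma invertible_if_bij_mult:
  fixes P Q :: "'a::semifield ^ 'n ^ 'n"
  assumes inj: "\<And>Z Z'. P ** Z ** Q = P ** Z' ** Q \<Longrightarrow> Z = Z'" and surj: "\<And>M. \<exists>Z. P ** Z ** Q = M"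
  shows "invertible P" "invertible Q"
proof -
  obtain Z where Z: "P ** Z ** Q = mat 1" using surj by blast
  have "P ** ((Z ** Q) ** P) ** Q = P ** mat 1 ** Q"
    using Z by (metis matrix_mul_assoc matrix_mul_lid matrix_mul_rid)
  then have "(Z ** Q) ** P = mat 1" by (rule inj)
  moreover have "P ** (Q ** (P ** Z)) ** Q = P ** mat 1 ** Q"
    using Z by (metis matrix_mul_assoc matrix_mul_lid matrix_mul_rid)
  then have "Q ** (P ** Z) = mat 1" by (rule inj)
  ultimately show "invertible P" "invertible Q"
    using Z unfolding invertible_def by (metis matrix_mul_assoc)+
qed

section \<open>Two-by-two blocks\<close>

definition block :: "'m \<Rightarrow> 'm \<Rightarrow> 'n \<Rightarrow> 'n \<Rightarrow> 'a \<Rightarrow> 'a \<Rightarrow> 'a \<Rightarrow> 'a \<Rightarrow> 'a::semifield ^ 'n ^ 'm" where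
  "block i k j l p q r s = (\<chi> a b. if a = i \<and> b = j then p else if a = i \<and> b = l then q
     else if a = k \<and> b = j then r else if a = k \<and> b = l then s else 0)"

lemma block_antidiag_mult:
  fixes p q r s x y :: "'a::semifield" and i k :: "'m::finite" and j l :: "'n::finite"
  assumes "i \<noteq> k"
  shows "block i k i k 0 x y 0 ** block i k j l p q r s = block i k j l (x * r) (x * s) (y * p) (y * q)"
proof -
  have "(block i k i k 0 x y 0 ** M) $ a $ b = (if a = i then x * M $ k $ b else if a = k then y * M $ i $ b else 0)"
    for M :: "'a ^ 'n ^ 'm" and a b
  proof -
    have "(block i k i k 0 x y 0 ** M) $ a $ b =
        (\<Sum>c\<in>UNIV. (if c = k then if a = i then x else 0 else 0) * M $ c $ b +
          (if c = i then if a = k then y else 0 else 0) * M $ c $ b)"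
      unfolding matrix_matrix_mult_def block_def using assms by (auto intro!: sum.cong)
    then show ?thesis using assms by (simp add: sum.distrib sum_if_eq)
  qed
  then show ?thesis using assms by (simp add: vec_eq_iff block_def)
qed

lemma transpose_block:
  assumes "i \<noteq> k" "j \<noteq> l"
  shows "transpose (block i k j l p q r s) = block j l i k p r q s"
proof -
  have "block i k j l p q r s $ b $ a = block j l i k p r q s $ a $ b" for a b
    using assms by (cases "a = j"; cases "a = l"; cases "b = i"; cases "b = k") (simp_all add: block_def)
  then show ?thesis by (simp add: vec_eq_iff transpose_def)
qed

lemma mult_block_antidiag:
  assumes "i \<noteq> k" "j \<noteq> l"
  shows "block i k j l p q r s ** block j l j l 0 x y 0 = block i k j l (q * y) (p * x) (s * y) (r * x)"
proof -
  have "block i k j l p q r s ** block j l j l 0 x y 0 =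
      transpose (block j l j l 0 y x 0 ** block j l i k p r q s)"
    using assms by (simp add: matrix_transpose_mul transpose_block)
  then show ?thesis
    using assms by (simp add: block_antidiag_mult transpose_block mult.commute)
qed

text \<open>Inverting the entries and rotating the block by a half-turn is left as well as right
  multiplication by antidiagonal blocks.\<close>
lemma green_le_H_block:
  fixes p q r s :: "'a::semifield" and i k j l :: "'n::finite"
  assumes ne: "i \<noteq> k" "j \<noteq> l"
    and inv: "p * p' = 1" "q * q' = 1" "r * r' = 1" "s * s' = 1"
  shows "green_le_H (block i k j l p q r s) (block i k j l s' r' q' p')"
proof -
  have cancel: "b * b' = 1 \<Longrightarrow> a * b * b' = a" "a * b = b * a" for a b b' :: 'a
    by (simp_all add: mult.assoc) (simp add: mult.commute)
  have "p * q * q' = p" "p * q * p' = q" "r * s * s' = r" "r * s * r' = s"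
    "r' * (p * r) = p" "s' * (q * s) = q" "p' * (p * r) = r" "q' * (q * s) = s"
    using cancel inv by metis+
  then have "block i k j l p q r s = block i k i k 0 (p * q) (r * s) 0 ** block i k j l s' r' q' p'"
    and "block i k j l p q r s = block i k j l s' r' q' p' ** block j l j l 0 (q * s) (p * r) 0"
    by (simp_all add: block_antidiag_mult[OF ne(1)] mult_block_antidiag[OF ne])
  then show ?thesis
    unfolding green_le_H_def green_le_L_def green_le_R_def by blast
qed

text \<open>Inverting the entries and applying a half-turn is an involution, so the reverse
  comparison is another instance of \<open>green_le_H_block\<close>.\<close>

lemma green_H_block:
  fixes p q r s :: "'a::semifield" and i k j l :: "'n::finite"
  assumes "i \<noteq> k" "j \<noteq> l"
    and "p * p' = 1" "q * q' = 1" "r * r' = 1" "s * s' = 1"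
  shows "green_H (block i k j l p q r s) (block i k j l s' r' q' p')"
  using green_le_H_block[OF assms] green_le_H_block[OF assms(1,2), of s' s r' r q' q p' p] assms(3-)
  unfolding green_H_def by (simp add: mult.commute)

section \<open>Entrywise and diagonal scaling\<close>

definition hadamard :: "('m \<Rightarrow> 'n \<Rightarrow> 'a::semifield) \<Rightarrow> 'a ^ 'n ^ 'm \<Rightarrow> 'a ^ 'n ^ 'm" where
  "hadamard d Z = (\<chi> i j. d i j * Z $ i $ j)"

definition diag :: "('n \<Rightarrow> 'a) \<Rightarrow> 'a::semifield ^ 'n ^ 'n" where
  "diag f = (\<chi> i j. if i = j then f i else 0)"

lemma diag_mult: "(diag f ** M) $ i $ j = f i * M $ i $ j"
  and mult_diag: "(M ** diag f) $ i $ j = M $ i $ j * f j"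
  by (simp_all add: diag_def matrix_matrix_mult_def sum_if_eq)
    (simp add: if_distrib if_distribR eq_commute cong: if_cong)

lemma invertible_diag:
  assumes "\<And>i. f i \<noteq> 0"
  shows "invertible (diag f)"
proof -
  have "diag f ** diag (\<lambda>i. sinv (f i)) = mat 1" "diag (\<lambda>i. sinv (f i)) ** diag f = mat 1"
    unfolding vec_eq_iff diag_mult by (simp_all add: diag_def mat_def mult_sinv sinv_mult assms)
  then show ?thesis unfolding invertible_def by blast
qed

text \<open>The shape matches \<open>mat_linear_unit_expansion\<close>, so that a linear map can be
  compared with a two-sided product term by term.\<close>

lemma matrix_mult_sandwich:
  "(P ** M ** Q) $ a $ b = (\<Sum>i\<in>UNIV. \<Sum>j\<in>UNIV. M $ i $ j * (P $ a $ i * Q $ j $ b))"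
  for M :: "'a::semifield ^ 'n ^ 'm"
proof -
  have "(P ** M ** Q) $ a $ b = (\<Sum>j\<in>UNIV. \<Sum>i\<in>UNIV. M $ i $ j * (P $ a $ i * Q $ j $ b))"
    by (simp add: matrix_matrix_mult_def sum_distrib_left sum_distrib_right ac_simps)
  then show ?thesis by (subst sum.swap) simp
qed

context H_preserver
begin

text \<open>With \<open>d\<close> the entrywise inverse of \<open>c\<close>, the map
  \<open>T\<close> sends \<open>P ** Z ** Q\<close> to \<open>hadamard d Z\<close>. Once all 2 by 2
  minors of \<open>d\<close> vanish, this entrywise scaling is multiplication by diagonal matrices
  on both sides.\<close>

lemma mult_form_if_inv_units_outer:
  assumes c: "\<And>i j. c i j \<noteq> 0"
    and U: "\<And>i j. inv T (unit_mat i j 1) = mat_scale (c i j) (outer (x i) (y j))"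
  shows "\<exists>P Q. invertible P \<and> invertible Q \<and> (\<forall>A. T A = P ** A ** Q)"
proof -
  define P where "P = (\<chi> a i. x i $ a)"
  define Q where "Q = (\<chi> j b. y j $ b)"
  define d where "d i j = sinv (c i j)" for i j
  have cd: "c i j * d i j = 1" and d: "d i j \<noteq> 0" for i j
    using c by (simp_all add: d_def mult_sinv sinv_nonzero)
  have inv_eq: "inv T Z = P ** hadamard c Z ** Q" for Z
    unfolding vec_eq_iff mat_linear_unit_expansion[OF linear_inv, of Z] matrix_mult_sandwich
    by (simp add: U P_def Q_def hadamard_def mat_scale_def outer_def ac_simps)
  have had: "hadamard c (hadamard d Z) = Z" for Z
    using cd by (simp add: hadamard_def vec_eq_iff flip: mult.assoc)
  have had': "hadamard d (hadamard c Z) = Z" for Z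
    using cd by (simp add: hadamard_def vec_eq_iff mult.commute[of "d _ _"] flip: mult.assoc)
  have T_PQ: "T (P ** Z ** Q) = hadamard d Z" for Z
    by (metis T_inv had inv_eq)
  have "Z = Z'" if "P ** Z ** Q = P ** Z' ** Q" for Z Z'
    using that by (metis T_PQ had)
  moreover have "\<exists>Z. P ** Z ** Q = M" for M
    by (metis inv_T inv_eq)
  ultimately have PQ: "invertible P" "invertible Q"
    using invertible_if_bij_mult by blast+
  have minors: "d i j * d k l = d i l * d k j" if ne: "i \<noteq> k" "j \<noteq> l" for i j k l
  proof -
    \<comment> \<open>Scaling by \<open>d\<close> turns \<open>?A\<close> into the all-ones block,
      and \<open>?B\<close> is its \<H>-related partner from \<open>green_H_block\<close>. Hence the
      image of \<open>?B\<close> is constant on the block, and two of its entries are the two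
      products of the minor.\<close>
    let ?A = "block i k j l (c i j) (c i l) (c k j) (c k l) :: 'a ^ 'n ^ 'n"
    let ?B = "block i k j l (d k l) (d k j) (d i l) (d i j) :: 'a ^ 'n ^ 'n"
    have A: "T (P ** ?A ** Q) = block i k j l 1 1 1 1"
      using cd ne unfolding T_PQ by (auto simp: hadamard_def block_def vec_eq_iff mult.commute)
    have B: "T (P ** ?B ** Q) =
        block i k j l (d i j * d k l) (d i l * d k j) (d k j * d i l) (d k l * d i j)"
      using ne unfolding T_PQ by (auto simp: hadamard_def block_def vec_eq_iff)
    have "block i k j l 1 1 1 1 = outer (axis i 1 + axis k 1) (axis j (1::'a) + axis l 1)"
      using ne by (auto simp: block_def outer_def axis_def vec_eq_iff)
    moreover have "axis a 1 + axis b (1::'a) \<noteq> 0" if "a \<noteq> b" for a b :: 'n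
      using that by (auto simp: axis_def vec_eq_iff intro!: exI[of _ a])
    ultimately have "rank_one (T (P ** ?A ** Q))"
      using ne unfolding A rank_one_def by blast
    moreover have "green_H (P ** ?B ** Q) (P ** ?A ** Q)"
      by (intro green_H_mult PQ green_H_block ne) (use cd in \<open>simp_all add: mult.commute\<close>)
    ultimately obtain s where "P ** ?B ** Q = mat_scale s (P ** ?A ** Q)"
      using scalar_if_green_H by blast
    then have "block i k j l (d i j * d k l) (d i l * d k j) (d k j * d i l) (d k l * d i j) =
        mat_scale s (block i k j l 1 1 1 1)"
      by (metis A B T_scale)
    then have "block i k j l (d i j * d k l) (d i l * d k j) (d k j * d i l) (d k l * d i j) $ i $ b =
        mat_scale s (block i k j l 1 1 1 1) $ i $ b" for b
      by simp
    from this[of j] this[of l] have "d i j * d k l = s" "d i l * d k j = s"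
      using ne by (simp_all add: block_def mat_scale_def)
    then show ?thesis by simp
  qed
  then have minors: "d i j * d k l = d i l * d k j" for i j k l
    by (cases "i = k"; cases "j = l") (simp_all add: mult.commute)
  \<comment> \<open>An arbitrary base index. The minor through \<open>(e, e)\<close> gives
    \<open>d i j\<close> as \<open>d i e * d e j\<close> divided by \<open>d e e\<close>, and
    \<open>c e e\<close> is the inverse of \<open>d e e\<close>.\<close>
  define e where "e = (undefined :: 'n)"
  define f where "f i = d i e" for i
  define g where "g j = d e j * c e e" for j
  have "d i j = f i * g j" for i j
    unfolding f_def g_def using minors[of i e e j] cd[of e e]
    by (metis mult.assoc mult.commute mult_1)
  then have had_eq: "hadamard d Z = diag f ** Z ** diag g" for Z
    by (simp add: vec_eq_iff hadamard_def mult_diag diag_mult ac_simps)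
  obtain P' Q' where P': "P ** P' = mat 1" "P' ** P = mat 1" and Q': "Q' ** Q = mat 1" "Q ** Q' = mat 1"
    using PQ by (auto simp: invertible_def)
  have "T A = (diag f ** P') ** A ** (Q' ** diag g)" for A
  proof -
    have "P ** (P' ** A ** Q') ** Q = A"
      using P' Q' by (metis matrix_mul_assoc matrix_mul_lid matrix_mul_rid)
    then show ?thesis
      using T_PQ[of "P' ** A ** Q'"] by (simp add: had_eq matrix_mul_assoc)
  qed
  moreover have "invertible P'" "invertible Q'"
    using P' Q' by (auto simp: invertible_def)
  then have "invertible (diag f ** P')" "invertible (Q' ** diag g)"
    by (auto intro!: invertible_mult invertible_diag simp: f_def g_def semifield_mult_eq_0 c d)
  ultimately show ?thesis by blast
qed

end

section \<open>Collinearity on the grid\<close>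

text \<open>In the application \<open>X\<close> and \<open>Y\<close> hold of two cells whose left, respectively right, factors are
  parallel.\<close>
lemma grid_no_cross:
  fixes X Y :: "'n \<times> 'n \<Rightarrow> 'n \<times> 'n \<Rightarrow> bool"
  assumes eqX: "equivp X" and eqY: "equivp Y"
    and XY: "\<And>a b. X a b \<Longrightarrow> Y a b \<Longrightarrow> a = b"
    and line: "\<And>i j k l. i = k \<or> j = l \<Longrightarrow> X (i, j) (k, l) \<or> Y (i, j) (k, l)"
    and "i \<noteq> k" "j \<noteq> l" and X: "X (i, j) (i, l)" "X (i, j) (k, j)"
  shows "X a b"
proof -
  note sym = equivp_symp[OF eqX] equivp_symp[OF eqY]
  note trans = equivp_transp[OF eqX] equivp_transp[OF eqY]
  \<comment> \<open>Otherwise \<open>(i, m)\<close> would be \<open>Y\<close>-related to both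
    \<open>(i, j)\<close> and \<open>(i, l)\<close>, making these two distinct cells related by both
    \<open>X\<close> and \<open>Y\<close>.\<close>
  have row: "X (i, j) (i, m)" for m
    using line[of i i j m] line[of i i l m] X(1) XY[of "(i, j)" "(i, l)"] \<open>j \<noteq> l\<close>
    by (metis Pair_inject sym trans)
  have col: "X (i, j) (m, j)" for m
    using line[of i m j j] line[of k m j j] X(2) XY[of "(i, j)" "(k, j)"] \<open>i \<noteq> k\<close>
    by (metis Pair_inject sym trans)
  have "X (i, j) (k', l')" for k' l'
  proof (cases "k' = i \<or> l' = j")
    case True
    then show ?thesis using row col by auto
  next
    case False
    \<comment> \<open>The cell \<open>(k', l')\<close> shares a line with each of these two cells.
      It cannot be \<open>Y\<close>-related to both, so \<open>X\<close> reaches it from one of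
      them.\<close>
    have "X (i, l') (k', j)" using row col sym trans by metis
    then have "\<not> Y (i, l') (k', j)" using XY False by blast
    then have "X (i, l') (k', l') \<or> X (k', j) (k', l')"
      using line[of i k' l' l'] line[of k' k' j l'] by (metis sym trans)
    then show ?thesis using row col trans by metis
  qed
  then show ?thesis using sym trans by (metis surj_pair)
qed

text \<open>By \<open>grid_no_cross\<close>, a cell with \<open>X\<close>-neighbours both in its row
  and in its column would make \<open>X\<close> total, and likewise for \<open>Y\<close>. So a
  single related pair in a row decides the type of every row and column.\<close>

lemma grid_relations:
  fixes X Y :: "'n \<times> 'n \<Rightarrow> 'n \<times> 'n \<Rightarrow> bool"
  assumes eqX: "equivp X" and eqY: "equivp Y"
    and XY: "\<And>a b. X a b \<Longrightarrow> Y a b \<Longrightarrow> a = b"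
    and line: "\<And>i j k l. i = k \<or> j = l \<Longrightarrow> X (i, j) (k, l) \<or> Y (i, j) (k, l)"
    and nX: "\<And>i k :: 'n. i \<noteq> k \<Longrightarrow> \<exists>a b. \<not> X a b"
    and nY: "\<And>i k :: 'n. i \<noteq> k \<Longrightarrow> \<exists>a b. \<not> Y a b"
  shows "(\<forall>i j l. X (i, j) (i, l)) \<and> (\<forall>i k j. Y (i, j) (k, j)) \<or>
    (\<forall>i j l. Y (i, j) (i, l)) \<and> (\<forall>i k j. X (i, j) (k, j))"
proof (cases "\<exists>i k :: 'n. i \<noteq> k")
  case False
  then have "a = b" for a b :: "'n \<times> 'n" by (metis surj_pair)
  then show ?thesis by (metis eqX eqY equivp_reflp)
next
  case True
  \<comment> \<open>Stated for arbitrary relations so that it also applies with \<open>X\<close> and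
    \<open>Y\<close> exchanged. The type spreads from the starting pair down column
    \<open>j0\<close>, from there along all rows, and then to all columns.\<close>
  have *: "(\<forall>i j l. X (i, j) (i, l)) \<and> (\<forall>i k j. Y (i, j) (k, j))"
    if eqX: "equivp X" and eqY: "equivp Y"
    and line: "\<And>i j k l. i = k \<or> j = l \<Longrightarrow> X (i, j) (k, l) \<or> Y (i, j) (k, l)"
    and noX: "\<And>i j k l. i \<noteq> k \<Longrightarrow> j \<noteq> l \<Longrightarrow> X (i, j) (i, l) \<Longrightarrow> X (i, j) (k, j) \<Longrightarrow> False"
    and noY: "\<And>i j k l. i \<noteq> k \<Longrightarrow> j \<noteq> l \<Longrightarrow> Y (i, j) (i, l) \<Longrightarrow> Y (i, j) (k, j) \<Longrightarrow> False"
    and start: "i0 \<noteq> k0" "j0 \<noteq> l0" "X (i0, j0) (i0, l0)"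
    for X Y :: "'n \<times> 'n \<Rightarrow> 'n \<times> 'n \<Rightarrow> bool" and i0 k0 j0 l0
  proof -
    have colY: "Y (i0, j0) (k, j0)" if "k \<noteq> i0" for k
      using line[of i0 k j0 j0] noX[of i0 k j0 l0] start that by blast
    have rowX': "X (k, j0) (k, l)" if "l \<noteq> j0" for k l
    proof -
      obtain k' where "k' \<noteq> k" "Y (k, j0) (k', j0)"
        using colY equivp_symp[OF eqY] start(1) by metis
      then show ?thesis
        using line[of k k j0 l] noY[of k k' j0 l] that by blast
    qed
    have rowX: "X (i, j) (i, l)" for i j l
      using rowX' equivp_reflp[OF eqX] equivp_symp[OF eqX] equivp_transp[OF eqX] by metis
    have "Y (i, j) (k, j)" for i k j
    proof (cases "i = k")
      case True
      then show ?thesis using equivp_reflp[OF eqY] by simp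
    next
      case False
      obtain l where "l \<noteq> j" using start(2) by metis
      then show ?thesis using noX[of i k j l] rowX line[of i k j j] False by blast
    qed
    with rowX show ?thesis by blast
  qed
  have noX: False if "i \<noteq> k" "j \<noteq> l" "X (i, j) (i, l)" "X (i, j) (k, j)" for i j k l
    using grid_no_cross[OF eqX eqY XY line that] nX[OF that(1)] by blast
  have noY: False if "i \<noteq> k" "j \<noteq> l" "Y (i, j) (i, l)" "Y (i, j) (k, j)" for i j k l
    using grid_no_cross[OF eqY eqX _ _ that] XY line nY[OF that(1)] by blast
  obtain i k :: 'n where "i \<noteq> k" using True by blast
  then consider "X (i, i) (i, k)" | "Y (i, i) (i, k)" using line by blast
  then show ?thesis
  proof cases
    case 1
    show ?thesis
      by (rule disjI1, rule *[of X Y i k i k, OF eqX eqY])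
        (erule line | erule (3) noX | erule (3) noY | fact)+
  next
    case 2
    have line': "Y (i, j) (k, l) \<or> X (i, j) (k, l)" if "i = k \<or> j = l" for i j k l
      using line[OF that] by blast
    show ?thesis
      by (rule disjI2, rule *[of Y X i k i k, OF eqY eqX])
        (erule line' | erule (3) noX | erule (3) noY | fact)+
  qed
qed

section \<open>The form of \<open>T\<close>\<close>

context H_preserver
begin

text \<open>Fixing representatives \<open>x i e\<close> and \<open>y e j\<close> moves all
  proportionality factors into one coefficient for each cell.\<close>

lemma mult_form_if_rows_columns_parallel:
  assumes U: "\<And>i j. inv T (unit_mat i j 1) = outer (x i j) (y i j)"
    and x: "\<And>i j l. parallel (x i j) (x i l)" and y: "\<And>i k j. parallel (y i j) (y k j)"
  shows "\<exists>P Q. invertible P \<and> invertible Q \<and> (\<forall>A. T A = P ** A ** Q)"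
proof -
  define e where "e = (undefined :: 'n)"
  have "\<forall>i j. \<exists>s. s \<noteq> 0 \<and> x i j = s *s x i e" "\<forall>i j. \<exists>t. t \<noteq> 0 \<and> y i j = t *s y e j"
    using x y unfolding parallel_def by blast+
  then obtain s t where s: "\<And>i j. s i j \<noteq> 0" "\<And>i j. x i j = s i j *s x i e"
    and t: "\<And>i j. t i j \<noteq> 0" "\<And>i j. y i j = t i j *s y e j"
    by metis
  show ?thesis
  proof (rule mult_form_if_inv_units_outer[of "\<lambda>i j. s i j * t i j" "\<lambda>i. x i e" "\<lambda>j. y e j"])
    show "s i j * t i j \<noteq> 0" for i j using s t by (simp add: semifield_mult_eq_0)
    show "inv T (unit_mat i j 1) = mat_scale (s i j * t i j) (outer (x i e) (y e j))" for i j
      unfolding U s(2)[of i j] t(2)[of i j] by (simp add: vec_eq_iff outer_def mat_scale_def ac_simps)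
  qed
qed

text \<open>Composing with the transpose exchanges left and right factors of the preimages, so facts
  about \<open>x\<close> yield those about \<open>y\<close>, and the direct form yields the
  transposed one.\<close>

lemma H_preserver_transpose: "H_preserver (\<lambda>A. T (transpose A))"
proof
  show "bij (\<lambda>A. T (transpose A))"
    by (rule o_bij[of "\<lambda>A. transpose (inv T A)"]) (simp_all add: fun_eq_iff T_inv inv_T)
  have "transpose (A + B) = transpose A + transpose B" "transpose (mat_scale s A) = mat_scale s (transpose A)"
    for A B :: "'a ^ 'n ^ 'n" and s
    by (simp_all add: transpose_def vec_eq_iff mat_scale_def)
  then show "mat_linear (\<lambda>A. T (transpose A))"
    by (simp add: mat_linear_def T_add T_scale)
  show "preserves (\<lambda>A. T (transpose A)) green_H"
    using preserves green_H_transpose unfolding preserves_def by blast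
qed

text \<open>If all left factors were multiples of one vector \<open>z\<close>, every value of
  \<open>inv T\<close> would be an outer product with \<open>z\<close>. The identity is such a
  value, which forces the matrices to be 1 by 1.\<close>

lemma not_all_outer_parallel:
  assumes U: "\<And>i j. inv T (unit_mat i j 1) = outer (x i j) (y i j)"
    and par: "\<And>i j k l. parallel (x i j) (x k l)"
  shows "i = (k :: 'n)"
proof (rule ccontr)
  assume "i \<noteq> k"
  define z where "z = x k k"
  have "\<forall>i j. \<exists>s. x i j = s *s z"
    using par unfolding parallel_def z_def by blast
  then obtain s where s: "\<And>i j. x i j = s i j *s z"
    by metis
  define w where "w b = (\<Sum>i\<in>UNIV. \<Sum>j\<in>UNIV. T (mat 1) $ i $ j * (s i j * y i j $ b))" for b
  have "mat 1 $ a $ b = z $ a * w b" for a b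
  proof -
    have "mat 1 $ a $ b = inv T (T (mat 1)) $ a $ b" by (simp add: inv_T)
    also have "\<dots> = z $ a * w b"
      unfolding mat_linear_unit_expansion[OF linear_inv, of "T (mat 1)"] U w_def sum_distrib_left
      by (intro sum.cong refl) (simp add: outer_def s ac_simps)
    finally show ?thesis .
  qed
  from this[of i i] this[of k k] this[of i k] \<open>i \<noteq> k\<close>
  have "1 = z $ i * w i" "1 = z $ k * w k" "z $ i * w k = 0"
    by (simp_all add: mat_def)
  then show False by (auto simp: semifield_mult_eq_0)
qed

lemma mult_form:
  "\<exists>P Q. invertible P \<and> invertible Q \<and>
    ((\<forall>A. T A = P ** A ** Q) \<or> (\<forall>A. T A = P ** transpose A ** Q))"
proof -
  interpret tr: H_preserver "\<lambda>A. T (transpose A)" by (rule H_preserver_transpose)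
  have inv_tr: "inv (\<lambda>A. T (transpose A)) A = transpose (inv T A)" for A
    by (metis T_inv tr.inv_T transpose_transpose)
  obtain x y where xy: "\<And>i j. x i j \<noteq> 0" "\<And>i j. y i j \<noteq> 0"
    and U: "\<And>i j. inv T (unit_mat i j 1) = outer (x i j) (y i j)"
    and line: "\<And>i j k l. i = k \<or> j = l \<Longrightarrow> parallel (x i j) (x k l) \<or> parallel (y i j) (y k l)"
    using inv_units_collinear by metis
  have U': "inv (\<lambda>A. T (transpose A)) (unit_mat i j 1) = outer (y i j) (x i j)" for i j
    by (simp add: inv_tr U) (simp add: outer_def transpose_def vec_eq_iff mult.commute)
  have equivp: "equivp (\<lambda>a b. parallel (z (fst a) (snd a)) (z (fst b) (snd b)))"
    for z :: "'n \<Rightarrow> 'n \<Rightarrow> 'a ^ 'n"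
    by (intro equivpI reflpI sympI transpI) (blast intro: parallel_refl parallel_sym parallel_trans)+
  \<comment> \<open>If both factors are parallel, the preimages are proportional, hence so are the
    units themselves.\<close>
  have inj: "(i, j) = (k, l)" if par: "parallel (x i j) (x k l)" "parallel (y i j) (y k l)" for i j k l
  proof (rule ccontr)
    assume ne: "(i, j) \<noteq> (k, l)"
    obtain s t where "x i j = s *s x k l" "y i j = t *s y k l"
      using par by (auto simp: parallel_def)
    then have "inv T (unit_mat i j 1) = inv T (mat_scale (s * t) (unit_mat k l 1))"
      by (simp add: inv_scale U) (simp add: outer_def mat_scale_def vec_eq_iff ac_simps)
    then have "unit_mat i j 1 = mat_scale (s * t) (unit_mat k l (1::'a))"
      by (metis T_inv)
    then have "unit_mat i j 1 $ i $ j = mat_scale (s * t) (unit_mat k l (1::'a)) $ i $ j"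
      by simp
    with ne show False by (auto simp: unit_mat_def mat_scale_def)
  qed
  define X where "X = (\<lambda>a b. parallel (x (fst a) (snd a)) (x (fst b) (snd b)))"
  define Y where "Y = (\<lambda>a b. parallel (y (fst a) (snd a)) (y (fst b) (snd b)))"
  have "(\<forall>i j l. X (i, j) (i, l)) \<and> (\<forall>i k j. Y (i, j) (k, j)) \<or>
    (\<forall>i j l. Y (i, j) (i, l)) \<and> (\<forall>i k j. X (i, j) (k, j))"
  proof (rule grid_relations)
    show "equivp X" "equivp Y" unfolding X_def Y_def by (rule equivp)+
    show "a = b" if "X a b" "Y a b" for a b
      using inj[of "fst a" "snd a" "fst b" "snd b"] that by (simp add: X_def Y_def)
    show "X (i, j) (k, l) \<or> Y (i, j) (k, l)" if "i = k \<or> j = l" for i j k l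
      using line[OF that] by (simp add: X_def Y_def)
    show "\<exists>a b. \<not> X a b" if "i \<noteq> k" for i k :: 'n
    proof (rule ccontr)
      assume "\<not> ?thesis"
      then have "parallel (x i j) (x k l)" for i j k l by (simp add: X_def)
      from not_all_outer_parallel[OF U this] that show False by blast
    qed
    show "\<exists>a b. \<not> Y a b" if "i \<noteq> k" for i k :: 'n
    proof (rule ccontr)
      assume "\<not> ?thesis"
      then have "parallel (y i j) (y k l)" for i j k l by (simp add: Y_def)
      from tr.not_all_outer_parallel[OF U' this] that show False by blast
    qed
  qed
  then consider "\<forall>i j l. parallel (x i j) (x i l)" "\<forall>i k j. parallel (y i j) (y k j)"
    | "\<forall>i j l. parallel (y i j) (y i l)" "\<forall>i k j. parallel (x i j) (x k j)"
    unfolding X_def Y_def fst_conv snd_conv by blast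
  then show ?thesis
  proof cases
    case 1
    then show ?thesis using mult_form_if_rows_columns_parallel[OF U] by blast
  next
    case 2
    then obtain P Q where "invertible P" "invertible Q" "\<forall>A. T (transpose A) = P ** A ** Q"
      using tr.mult_form_if_rows_columns_parallel[OF U'] by blast
    then show ?thesis by (metis transpose_transpose)
  qed
qed

end

theorem theorem4p4:
  fixes T :: "'a::semifield ^ 'n ^ 'n \<Rightarrow> 'a ^ 'n ^ 'n"
  assumes "bij T" and "mat_linear T"
  shows "(preserves T green_H \<longleftrightarrow> preserves T green_le_H) \<and>
         (preserves T green_le_H \<longleftrightarrow>
            (\<exists>P Q :: 'a ^ 'n ^ 'n. invertible P \<and> invertible Q \<and>
               ((\<forall>A. T A = P ** A ** Q) \<or> (\<forall>A. T A = P ** transpose A ** Q))))"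
    (is "_ \<and> (_ \<longleftrightarrow> ?form)")
proof -
  have "preserves T green_H" if "preserves T green_le_H"
    using that unfolding preserves_def green_H_def by blast
  moreover have ?form if "preserves T green_H"
    using assms that by (intro H_preserver.mult_form H_preserver.intro)
  moreover have "preserves T green_le_H" if ?form
    using that unfolding preserves_def by (metis green_le_H_mult green_le_H_transpose)
  ultimately show ?thesis by blast
qed

end
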